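(* Let $S$ be a commutative semiring, $T\subseteq S$ a multiplicatively closed set containing $1$, and $I$ an ideal of $S$ such that $(S,T,I)$ satisfies the maximal-disjointness hypothesis. (1) If $J$ is an $I$-relative $z$-ideal of $S$, then $T^{-1}J$ is a $z$-ideal of $T^{-1}S$. (2) If $K$ is a $z$-ideal of $T^{-1}S$, then its contraction $K^c$ is a $z$-ideal of $S$.
   Context: A semiring here is commutative with $0$ and $1$: $(S,+,0)$ and $(S,\cdot,1)$ are commutative monoids, multiplication distributes over addition, and $0s=0$. An ideal is a non-empty subset closed under addition and under multiplication by arbitrary elements; maximal ideals are proper. $\mathrm{Max}(S)$ is the set of maximal ideals and $\mathcal M(a)=\{M\in\mathrm{Max}(S)\mid a\in M\}$. An ideal $K$ of a semiring is a $z$-ideal if $a\in K$ and $\mathcal M(a)=\mathcal M(b)$ imply $b\in K$ (hulls taken in that semiring). $f:S\to T^{-1}S$, $a\mapsto a/1$, is the localization map ($a/s=b/t$ iff $uta=usb$ for some $u\in T$). For an ideal $J$ of $S$, $T^{-1}J=\{a/s\mid a\in J,\ s\in T\}$ is its extension; for an ideal $K$ of $T^{-1}S$, $K^c=f^{-1}(K)$ is its contraction. Put $\mathcal V_{\max}(I)=\{M\in\mathrm{Max}(S)\mid I\subseteq M\}$. The triple $(S,T,I)$ satisfies the maximal-disjointness hypothesis if extension and contraction give a bijection $\mathcal V_{\max}(I)\leftrightarrow\mathrm{Max}(T^{-1}S)$, $M\mapsto T^{-1}M$, and for every $M\in\mathcal V_{\max}(I)$ one has $M\cap T=\varnothing$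 and $a/s\in T^{-1}M\Leftrightarrow a\in M$ for all $a\in S$, $s\in T$. An ideal $J$ of $S$ is an $I$-relative $z$-ideal if $a\in J$, $b\in S$ and $\mathcal M(a)\cap\mathcal V_{\max}(I)=\mathcal M(b)\cap\mathcal V_{\max}(I)$ imply $b\in J$. *)

theory Defs
  imports "HOL-Algebra.Ring"
begin

text \<open>
  HOL-Algebra's \<open>ideal\<close> and \<open>maximalideal\<close> presuppose a ring, so ideals are
  introduced here for semirings. The one-element semiring is allowed
  throughout; in particular a localization may be trivial.
\<close>

definition semiring_ideal :: "'a set \<Rightarrow> ('a, 'm) ring_scheme \<Rightarrow> bool" where
  "semiring_ideal J S \<longleftrightarrow>
     J \<subseteq> carrier S \<and> J \<noteq> {} \<and>
     (\<forall>a\<in>J. \<forall>b\<in>J. a \<oplus>\<^bsub>S\<^esub> b \<in> J) \<and>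
     (\<forall>r\<in>carrier S. \<forall>a\<in>J. r \<otimes>\<^bsub>S\<^esub> a \<in> J)"

definition maximal_semiring_ideal :: "'a set \<Rightarrow> ('a, 'm) ring_scheme \<Rightarrow> bool" where
  "maximal_semiring_ideal M S \<longleftrightarrow>
     semiring_ideal M S \<and> M \<noteq> carrier S \<and>
     (\<forall>J. semiring_ideal J S \<longrightarrow> M \<subseteq> J \<longrightarrow> J = M \<or> J = carrier S)"

definition max_ideals :: "('a, 'm) ring_scheme \<Rightarrow> 'a set set" where
  "max_ideals S = {M. maximal_semiring_ideal M S}"

definition hull :: "('a, 'm) ring_scheme \<Rightarrow> 'a \<Rightarrow> 'a set set" where
  "hull S a = {M \<in> max_ideals S. a \<in> M}"

definition V_max :: "('a, 'm) ring_scheme \<Rightarrow> 'a set \<Rightarrow> 'a set set" where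
  "V_max S I = {M \<in> max_ideals S. I \<subseteq> M}"

definition z_ideal :: "'a set \<Rightarrow> ('a, 'm) ring_scheme \<Rightarrow> bool" where
  "z_ideal K S \<longleftrightarrow>
     semiring_ideal K S \<and>
     (\<forall>a\<in>K. \<forall>b\<in>carrier S. hull S a = hull S b \<longrightarrow> b \<in> K)"

definition relative_z_ideal :: "'a set \<Rightarrow> 'a set \<Rightarrow> ('a, 'm) ring_scheme \<Rightarrow> bool" where
  "relative_z_ideal I J S \<longleftrightarrow>
     semiring_ideal J S \<and>
     (\<forall>a\<in>J. \<forall>b\<in>carrier S. hull S a \<inter> V_max S I = hull S b \<inter> V_max S I \<longrightarrow> b \<in> J)"


definition frac_rel :: "('a, 'm) ring_scheme \<Rightarrow> 'a set \<Rightarrow> (('a \<times> 'a) \<times> ('a \<times> 'a)) set" where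
  "frac_rel S T =
     {((a, s), (b, t)) | a s b t.
        a \<in> carrier S \<and> s \<in> T \<and> b \<in> carrier S \<and> t \<in> T \<and>
        (\<exists>u\<in>T. u \<otimes>\<^bsub>S\<^esub> t \<otimes>\<^bsub>S\<^esub> a = u \<otimes>\<^bsub>S\<^esub> s \<otimes>\<^bsub>S\<^esub> b)}"

definition frac :: "('a, 'm) ring_scheme \<Rightarrow> 'a set \<Rightarrow> 'a \<Rightarrow> 'a \<Rightarrow> ('a \<times> 'a) set" where
  "frac S T a s = frac_rel S T `` {(a, s)}"

text \<open>
  The unions defining the operations range over all representatives of the two
  arguments; all the fractions in each union coincide, see \<open>frac_mult\<close> and
  \<open>frac_add\<close> below.
\<close>

definition localization :: "('a, 'm) ring_scheme \<Rightarrow> 'a set \<Rightarrow> ('a \<times> 'a) set ring" where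
  "localization S T =
     \<lparr> carrier = (carrier S \<times> T) // frac_rel S T,
       mult = (\<lambda>X Y. \<Union>(a, s)\<in>X. \<Union>(b, t)\<in>Y. frac S T (a \<otimes>\<^bsub>S\<^esub> b) (s \<otimes>\<^bsub>S\<^esub> t)),
       one = frac S T \<one>\<^bsub>S\<^esub> \<one>\<^bsub>S\<^esub>,
       zero = frac S T \<zero>\<^bsub>S\<^esub> \<one>\<^bsub>S\<^esub>,
       add = (\<lambda>X Y. \<Union>(a, s)\<in>X. \<Union>(b, t)\<in>Y.
                frac S T ((t \<otimes>\<^bsub>S\<^esub> a) \<oplus>\<^bsub>S\<^esub> (s \<otimes>\<^bsub>S\<^esub> b)) (s \<otimes>\<^bsub>S\<^esub> t)) \<rparr>"

definition loc_map :: "('a, 'm) ring_scheme \<Rightarrow> 'a set \<Rightarrow> 'a \<Rightarrow> ('a \<times> 'a) set" where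
  "loc_map S T a = frac S T a \<one>\<^bsub>S\<^esub>"

definition extension :: "('a, 'm) ring_scheme \<Rightarrow> 'a set \<Rightarrow> 'a set \<Rightarrow> ('a \<times> 'a) set set" where
  "extension S T J = {frac S T a s | a s. a \<in> J \<and> s \<in> T}"

definition contraction :: "('a, 'm) ring_scheme \<Rightarrow> 'a set \<Rightarrow> ('a \<times> 'a) set set \<Rightarrow> 'a set" where
  "contraction S T K = {a \<in> carrier S. loc_map S T a \<in> K}"

definition maximal_disjointness :: "('a, 'm) ring_scheme \<Rightarrow> 'a set \<Rightarrow> 'a set \<Rightarrow> bool" where
  "maximal_disjointness S T I \<longleftrightarrow>
     bij_betw (extension S T) (V_max S I) (max_ideals (localization S T)) \<and>
     (\<forall>M\<in>V_max S I. contraction S T (extension S T M) = M) \<and>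
     (\<forall>N\<in>max_ideals (localization S T). extension S T (contraction S T N) = N) \<and>
     (\<forall>M\<in>V_max S I. M \<inter> T = {} \<and>
        (\<forall>a\<in>carrier S. \<forall>s\<in>T. frac S T a s \<in> extension S T M \<longleftrightarrow> a \<in> M))"


locale semiring_localization = semiring S + comm_monoid S + submonoid T S
  for S (structure) and T
begin

lemma T_carrier [simp]: "s \<in> T \<Longrightarrow> s \<in> carrier S"
  using subset by blast

lemma frac_relI:
  assumes "a \<in> carrier S" "b \<in> carrier S" "s \<in> T" "t \<in> T" "u \<in> T"
    and "u \<otimes> t \<otimes> a = u \<otimes> s \<otimes> b"
  shows "((a, s), (b, t)) \<in> frac_rel S T"
  using assms unfolding frac_rel_def by blast

lemma equiv_frac_rel: "equiv (carrier S \<times> T) (frac_rel S T)"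
proof (rule equivI)
  show "refl_on (carrier S \<times> T) (frac_rel S T)"
    unfolding refl_on_def frac_rel_def by auto
  show "frac_rel S T \<subseteq> (carrier S \<times> T) \<times> (carrier S \<times> T)"
    unfolding frac_rel_def by auto
  show "sym (frac_rel S T)"
    by (rule symI) (clarsimp simp: frac_rel_def, metis)
  show "trans (frac_rel S T)"
  proof (rule transI, clarify)
    fix a s b t c r
    assume "((a, s), (b, t)) \<in> frac_rel S T" "((b, t), (c, r)) \<in> frac_rel S T"
    then obtain u v where
      c: "a \<in> carrier S" "b \<in> carrier S" "c \<in> carrier S" "s \<in> T" "t \<in> T" "r \<in> T" "u \<in> T" "v \<in> T"
      and u: "u \<otimes> t \<otimes> a = u \<otimes> s \<otimes> b" and v: "v \<otimes> r \<otimes> b = v \<otimes> t \<otimes> c"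
      unfolding frac_rel_def by auto
    have "(u \<otimes> v \<otimes> t) \<otimes> r \<otimes> a = (v \<otimes> r) \<otimes> (u \<otimes> t \<otimes> a)"
      using c by (simp add: m_ac)
    also have "\<dots> = (u \<otimes> s) \<otimes> (v \<otimes> r \<otimes> b)"
      unfolding u using c by (simp add: m_ac)
    also have "\<dots> = (u \<otimes> v \<otimes> t) \<otimes> s \<otimes> c"
      unfolding v using c by (simp add: m_ac)
    finally show "((a, s), (c, r)) \<in> frac_rel S T"
      using c by (intro frac_relI[where u = "u \<otimes> v \<otimes> t"]) auto
  qed
qed

lemma frac_eq_iff:
  assumes "a \<in> carrier S" "s \<in> T" "b \<in> carrier S" "t \<in> T"
  shows "frac S T a s = frac S T b t \<longleftrightarrow> (\<exists>u\<in>T. u \<otimes> t \<otimes> a = u \<otimes> s \<otimes> b)"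
  using assms eq_equiv_class_iff[OF equiv_frac_rel, of "(a, s)" "(b, t)"]
  unfolding frac_def by (auto simp: frac_rel_def)

lemma frac_closed [simp]:
  "a \<in> carrier S \<Longrightarrow> s \<in> T \<Longrightarrow> frac S T a s \<in> carrier (localization S T)"
  unfolding frac_def localization_def by (auto intro: quotientI)

lemma localization_cases:
  assumes "X \<in> carrier (localization S T)"
  obtains a s where "a \<in> carrier S" "s \<in> T" "X = frac S T a s"
  using assms unfolding localization_def frac_def by (auto elim!: quotientE)

lemma frac_mult:
  assumes "a \<in> carrier S" "s \<in> T" "b \<in> carrier S" "t \<in> T"
  shows "frac S T a s \<otimes>\<^bsub>localization S T\<^esub> frac S T b t = frac S T (a \<otimes> b) (s \<otimes> t)"
proof -
  have "congruent2 (frac_rel S T) (frac_rel S T) (\<lambda>(a, s) (b, t). frac S T (a \<otimes> b) (s \<otimes> t))"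
  proof (rule congruent2_commuteI[OF equiv_frac_rel]; clarify)
    fix a s b t c r
    assume "c \<in> carrier S" "r \<in> T" and "((a, s), (b, t)) \<in> frac_rel S T"
    then obtain u where
      c: "a \<in> carrier S" "b \<in> carrier S" "c \<in> carrier S" "s \<in> T" "t \<in> T" "r \<in> T" "u \<in> T"
      and u: "u \<otimes> t \<otimes> a = u \<otimes> s \<otimes> b"
      unfolding frac_rel_def by auto
    have "u \<otimes> (r \<otimes> t) \<otimes> (c \<otimes> a) = r \<otimes> c \<otimes> (u \<otimes> t \<otimes> a)"
      using c by (simp add: m_ac)
    also have "\<dots> = u \<otimes> (r \<otimes> s) \<otimes> (c \<otimes> b)"
      unfolding u using c by (simp add: m_ac)
    finally show "frac S T (c \<otimes> a) (r \<otimes> s) = frac S T (c \<otimes> b) (r \<otimes> t)"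
      using c by (subst frac_eq_iff) auto
  qed (simp_all add: m_comm)
  from UN_equiv_class2[OF equiv_frac_rel equiv_frac_rel this, of "(a, s)" "(b, t)"] assms
  show ?thesis unfolding localization_def frac_def[of S T a s] frac_def[of S T b t]
    by (simp add: split_def)
qed

lemma frac_add:
  assumes "a \<in> carrier S" "s \<in> T" "b \<in> carrier S" "t \<in> T"
  shows "frac S T a s \<oplus>\<^bsub>localization S T\<^esub> frac S T b t
           = frac S T ((t \<otimes> a) \<oplus> (s \<otimes> b)) (s \<otimes> t)"
proof -
  have "congruent2 (frac_rel S T) (frac_rel S T)
          (\<lambda>(a, s) (b, t). frac S T ((t \<otimes> a) \<oplus> (s \<otimes> b)) (s \<otimes> t))"
  proof (rule congruent2_commuteI[OF equiv_frac_rel]; clarify)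
    fix a s b t c r
    assume "c \<in> carrier S" "r \<in> T" and "((a, s), (b, t)) \<in> frac_rel S T"
    then obtain u where
      c: "a \<in> carrier S" "b \<in> carrier S" "c \<in> carrier S" "s \<in> T" "t \<in> T" "r \<in> T" "u \<in> T"
      and u: "u \<otimes> t \<otimes> a = u \<otimes> s \<otimes> b"
      unfolding frac_rel_def by auto
    have "u \<otimes> (r \<otimes> t) \<otimes> (s \<otimes> c \<oplus> r \<otimes> a)
            = u \<otimes> r \<otimes> t \<otimes> s \<otimes> c \<oplus> r \<otimes> r \<otimes> (u \<otimes> t \<otimes> a)"
      using c by (simp add: r_distr m_ac)
    also have "\<dots> = u \<otimes> (r \<otimes> s) \<otimes> (t \<otimes> c \<oplus> r \<otimes> b)"
      unfolding u using c by (simp add: r_distr m_ac)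
    finally show "frac S T (s \<otimes> c \<oplus> r \<otimes> a) (r \<otimes> s) = frac S T (t \<otimes> c \<oplus> r \<otimes> b) (r \<otimes> t)"
      using c by (subst frac_eq_iff) auto
  qed (simp_all add: m_comm a_comm)
  from UN_equiv_class2[OF equiv_frac_rel equiv_frac_rel this, of "(a, s)" "(b, t)"] assms
  show ?thesis unfolding localization_def frac_def[of S T a s] frac_def[of S T b t]
    by (simp add: split_def)
qed

lemma frac_zero: "\<zero>\<^bsub>localization S T\<^esub> = frac S T \<zero> \<one>"
  and frac_one: "\<one>\<^bsub>localization S T\<^esub> = frac S T \<one> \<one>"
  by (simp_all add: localization_def)

lemma frac_zero_eq: "s \<in> T \<Longrightarrow> frac S T \<zero> s = frac S T \<zero> \<one>"
  by (subst frac_eq_iff) auto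

lemma comm_monoid_localization: "comm_monoid (localization S T)"
  by (rule comm_monoidI)
     (auto elim!: localization_cases simp: frac_mult frac_one m_ac)

lemma semiring_localization: "semiring (localization S T)"
proof -
  interpret L: comm_monoid "localization S T" by (rule comm_monoid_localization)
  have add: "abelian_monoid (localization S T)"
    by (rule abelian_monoidI)
       (auto elim!: localization_cases simp: frac_add frac_zero r_distr m_ac a_ac)
  have distr: "(x \<oplus>\<^bsub>localization S T\<^esub> y) \<otimes>\<^bsub>localization S T\<^esub> z
        = x \<otimes>\<^bsub>localization S T\<^esub> z \<oplus>\<^bsub>localization S T\<^esub> y \<otimes>\<^bsub>localization S T\<^esub> z"
    if xyz: "x \<in> carrier (localization S T)" "y \<in> carrier (localization S T)"
      "z \<in> carrier (localization S T)" for x y z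
  proof -
    obtain a s b t c r where
      c: "a \<in> carrier S" "b \<in> carrier S" "c \<in> carrier S" "s \<in> T" "t \<in> T" "r \<in> T"
      and e: "x = frac S T a s" "y = frac S T b t" "z = frac S T c r"
      using xyz by (metis localization_cases)
    have "\<one> \<otimes> ((s \<otimes> r) \<otimes> (t \<otimes> r)) \<otimes> ((t \<otimes> a \<oplus> s \<otimes> b) \<otimes> c)
        = \<one> \<otimes> ((s \<otimes> t) \<otimes> r) \<otimes> ((t \<otimes> r) \<otimes> (a \<otimes> c) \<oplus> (s \<otimes> r) \<otimes> (b \<otimes> c))"
      using c by (simp add: l_distr r_distr m_ac)
    then show ?thesis unfolding e using c
      by (simp add: frac_add frac_mult, subst frac_eq_iff) (auto intro: bexI[of _ \<one>])
  qed
  have null: "\<zero>\<^bsub>localization S T\<^esub> \<otimes>\<^bsub>localization S T\<^esub> x = \<zero>\<^bsub>localization S T\<^esub>"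
    if "x \<in> carrier (localization S T)" for x
    using that by (elim localization_cases) (simp add: frac_mult frac_zero, rule frac_zero_eq)
  show ?thesis
    using add distr null L.monoid_axioms abelian_monoid.a_closed[OF add]
      abelian_monoid.zero_closed[OF add]
    by (intro semiring.intro semiring_axioms.intro) (simp_all add: L.m_comm)
qed

end

end

theory Submission
  imports Defs
begin

text \<open>
  Under maximal disjointness the maximal ideals containing \<open>a/s\<close> are exactly the extensions of
  the maximal ideals containing both \<open>I\<close> and \<open>a\<close>. Equality of hulls in the localization therefore
  coincides with equality of hulls relative to \<open>I\<close>, which is implied by equality of hulls in \<open>S\<close>.
\<close>

text \<open>Surjectivity of the bijection writes every maximal ideal of the localization as the
  extension of some \<open>M\<close> in \<open>V_max S I\<close>. The membership criterion then
  tests only the numerator, so the result is independent of \<open>s\<close>.\<close>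

lemma hull_frac:
  assumes "maximal_disjointness S T I" "a \<in> carrier S" "s \<in> T"
  shows "hull (localization S T) (frac S T a s) = extension S T ` (hull S a \<inter> V_max S I)"
proof -
  have "max_ideals (localization S T) = extension S T ` V_max S I"
    and "\<And>M. M \<in> V_max S I \<Longrightarrow> frac S T a s \<in> extension S T M \<longleftrightarrow> a \<in> M"
    using assms unfolding maximal_disjointness_def bij_betw_def by auto
  then show ?thesis
    unfolding hull_def V_max_def by auto
qed

text \<open>Both relative hulls lie inside \<open>V_max S I\<close>, where extension is injective,
  so equal images come only from equal sets.\<close>

lemma hull_frac_eq_iff:
  assumes "maximal_disjointness S T I" "a \<in> carrier S" "s \<in> T" "b \<in> carrier S" "t \<in> T"
  shows "hull (localization S T) (frac S T a s) = hull (localization S T) (frac S T b t)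
    \<longleftrightarrow> hull S a \<inter> V_max S I = hull S b \<inter> V_max S I"
proof -
  have "inj_on (extension S T) (V_max S I)"
    using assms(1) unfolding maximal_disjointness_def bij_betw_def by auto
  then show ?thesis
    unfolding hull_frac[OF assms(1-3)] hull_frac[OF assms(1,4,5)]
    by (rule inj_on_image_eq_iff) auto
qed

context semiring_localization
begin

text \<open>The sum of \<open>a/s\<close> and \<open>b/t\<close> has numerator
  \<open>t \<otimes> a \<oplus> s \<otimes> b\<close>, again in \<open>J\<close>; products are
  handled in the same way.\<close>

lemma semiring_ideal_extension:
  assumes "semiring_ideal J S"
  shows "semiring_ideal (extension S T J) (localization S T)"
proof -
  have J: "J \<subseteq> carrier S" "J \<noteq> {}" "\<And>a b. a \<in> J \<Longrightarrow> b \<in> J \<Longrightarrow> a \<oplus> b \<in> J"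
    "\<And>r a. r \<in> carrier S \<Longrightarrow> a \<in> J \<Longrightarrow> r \<otimes> a \<in> J"
    using assms unfolding semiring_ideal_def by auto
  have frac_in: "frac S T a s \<in> extension S T J" if "a \<in> J" "s \<in> T" for a s
    using that unfolding extension_def by blast
  have ext_cases: "\<exists>a s. a \<in> J \<and> a \<in> carrier S \<and> s \<in> T \<and> X = frac S T a s"
    if "X \<in> extension S T J" for X
    using that J(1) unfolding extension_def by blast
  show ?thesis
    unfolding semiring_ideal_def
  proof (intro conjI ballI)
    show "extension S T J \<subseteq> carrier (localization S T)"
      by (auto dest!: ext_cases)
    show "extension S T J \<noteq> {}"
      using J(2) frac_in[OF _ one_closed] by blast
  next
    fix X Y assume "X \<in> extension S T J" "Y \<in> extension S T J"
    then show "X \<oplus>\<^bsub>localization S T\<^esub> Y \<in> extension S T J"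
      by (auto dest!: ext_cases simp: frac_add intro!: frac_in J)
  next
    fix X Y assume "X \<in> carrier (localization S T)" "Y \<in> extension S T J"
    then show "X \<otimes>\<^bsub>localization S T\<^esub> Y \<in> extension S T J"
      by (auto elim!: localization_cases dest!: ext_cases simp: frac_mult intro!: frac_in J)
  qed
qed

text \<open>This is the preimage of an ideal under \<open>loc_map\<close>, which respects both
  operations.\<close>

lemma semiring_ideal_contraction:
  assumes "semiring_ideal K (localization S T)"
  shows "semiring_ideal (contraction S T K) S"
proof -
  interpret L: semiring "localization S T" by (rule semiring_localization)
  have K: "K \<subseteq> carrier (localization S T)" "K \<noteq> {}"
    "\<And>X Y. X \<in> K \<Longrightarrow> Y \<in> K \<Longrightarrow> X \<oplus>\<^bsub>localization S T\<^esub> Y \<in> K"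
    "\<And>X Y. X \<in> carrier (localization S T) \<Longrightarrow> Y \<in> K \<Longrightarrow> X \<otimes>\<^bsub>localization S T\<^esub> Y \<in> K"
    using assms unfolding semiring_ideal_def by auto
  have loc_map_add: "loc_map S T a \<oplus>\<^bsub>localization S T\<^esub> loc_map S T b = loc_map S T (a \<oplus> b)"
    and loc_map_mult: "loc_map S T a \<otimes>\<^bsub>localization S T\<^esub> loc_map S T b = loc_map S T (a \<otimes> b)"
    if "a \<in> carrier S" "b \<in> carrier S" for a b
    using that by (simp_all add: loc_map_def frac_add frac_mult)
  have loc_map_closed: "loc_map S T a \<in> carrier (localization S T)" if "a \<in> carrier S" for a
    using that by (simp add: loc_map_def)
  \<comment> \<open>Ideals are only required to be non-empty, so zero is obtained by multiplying
    some \<open>X\<close> in \<open>K\<close> by zero; it is the image of \<open>\<zero>\<close> and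
    makes the contraction non-empty.\<close>
  obtain X where "X \<in> K" "X \<in> carrier (localization S T)" using K(1,2) by blast
  then have "\<zero>\<^bsub>localization S T\<^esub> \<in> K"
    using K(4)[OF L.zero_closed, of X] by simp
  then have "\<zero> \<in> contraction S T K"
    by (simp add: contraction_def loc_map_def frac_zero)
  moreover have "a \<oplus> b \<in> contraction S T K"
    if "a \<in> contraction S T K" "b \<in> contraction S T K" for a b
    using that K(3)[of "loc_map S T a" "loc_map S T b"]
    by (simp add: contraction_def loc_map_add)
  moreover have "r \<otimes> a \<in> contraction S T K"
    if "r \<in> carrier S" "a \<in> contraction S T K" for r a
    using that K(4)[of "loc_map S T r" "loc_map S T a"]
    by (simp add: contraction_def loc_map_mult loc_map_closed)
  ultimately show ?thesis
    unfolding semiring_ideal_def by (auto simp: contraction_def)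
qed

lemma z_ideal_extension:
  assumes md: "maximal_disjointness S T I" and J: "relative_z_ideal I J S"
  shows "z_ideal (extension S T J) (localization S T)"
  unfolding z_ideal_def
proof (intro conjI ballI impI)
  have ideal: "semiring_ideal J S"
    using J unfolding relative_z_ideal_def by blast
  then show "semiring_ideal (extension S T J) (localization S T)"
    by (rule semiring_ideal_extension)
  fix X Y
  assume "X \<in> extension S T J" "Y \<in> carrier (localization S T)"
    and eq: "hull (localization S T) X = hull (localization S T) Y"
  \<comment> \<open>Membership of \<open>X\<close> in the extension supplies a representative with
    numerator in \<open>J\<close>; for \<open>Y\<close> any representative will do, and the relative
    \<open>z\<close>-property puts its numerator in \<open>J\<close>.\<close>
  then obtain a s b t where a: "a \<in> J" "s \<in> T" "X = frac S T a s"
    and b: "b \<in> carrier S" "t \<in> T" "Y = frac S T b t"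
    unfolding extension_def by (auto elim!: localization_cases)
  have "a \<in> carrier S"
    using a(1) ideal unfolding semiring_ideal_def by blast
  then have "hull S a \<inter> V_max S I = hull S b \<inter> V_max S I"
    using eq a b hull_frac_eq_iff[OF md] by simp
  then have "b \<in> J"
    using J a b unfolding relative_z_ideal_def by blast
  then show "Y \<in> extension S T J"
    using b unfolding extension_def by blast
qed

lemma z_ideal_contraction:
  assumes md: "maximal_disjointness S T I" and K: "z_ideal K (localization S T)"
  shows "z_ideal (contraction S T K) S"
  unfolding z_ideal_def
proof (intro conjI ballI impI)
  show "semiring_ideal (contraction S T K) S"
    using K semiring_ideal_contraction unfolding z_ideal_def by blast
  fix a b
  assume a: "a \<in> contraction S T K" and b: "b \<in> carrier S" and eq: "hull S a = hull S b"
  \<comment> \<open>Equal hulls in \<open>S\<close> stay equal after intersection with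
    \<open>V_max S I\<close>; the hull criterion is then applied with both denominators
    \<open>\<one>\<close>.\<close>
  have "hull (localization S T) (loc_map S T a) = hull (localization S T) (loc_map S T b)"
    using a b eq hull_frac_eq_iff[OF md] by (simp add: loc_map_def contraction_def)
  moreover have "loc_map S T a \<in> K" "loc_map S T b \<in> carrier (localization S T)"
    using a b by (simp_all add: contraction_def loc_map_def)
  ultimately show "b \<in> contraction S T K"
    using K b unfolding z_ideal_def contraction_def by blast
qed

end

theorem theorem6p3:
  fixes S :: "('a, 'm) ring_scheme" and T I :: "'a set"
  assumes "semiring S" and "comm_monoid S"
    and "submonoid T S"
    and "semiring_ideal I S"
    and "maximal_disjointness S T I"
  shows "(\<forall>J. relative_z_ideal I J S \<longrightarrow> z_ideal (extension S T J) (localization S T)) \<and>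
         (\<forall>K. z_ideal K (localization S T) \<longrightarrow> z_ideal (contraction S T K) S)"
proof -
  interpret semiring_localization S T
    using assms(1-3) by (rule semiring_localization.intro)
  show ?thesis
    using z_ideal_extension[OF assms(5)] z_ideal_contraction[OF assms(5)] by blast
qed

end
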